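(* Let $F\subset\mathbb{C}$ be a closed set. Then $F$ is an Arakelian set if and only if for every $f\in A(F)$ with no zeros in $F$ there exists $g\in A(F)$ such that $e^{g}=f$ in $F$.
   Context: For a closed set $F\subset\mathbb{C}$ with interior $F^\circ$, $A(F)$ denotes the set of functions $f:F\to\mathbb{C}$ that are continuous on $F$ and holomorphic in $F^\circ$. A hole of a closed set $E\subset\mathbb{C}$ is any bounded connected component of $\mathbb{C}\setminus E$. A closed set $F\subset\mathbb{C}$ is called an Arakelian set if and only if both of the following hold: (1) $F$ has no holes; (2) for every compact subset $K\subset\mathbb{C}$, the union of all holes of $F\cup K$ is bounded. *)

theory Defs
  imports "HOL-Complex_Analysis.Complex_Analysis"
begin

definition holes :: "complex set \<Rightarrow> complex set set" where
  "holes E = {C \<in> components (- E). bounded C}"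

definition arakelian_set :: "complex set \<Rightarrow> bool" where
  "arakelian_set F \<longleftrightarrow>
     closed F \<and> holes F = {} \<and> (\<forall>K. compact K \<longrightarrow> bounded (\<Union> (holes (F \<union> K))))"

(* Functions on F are represented by total functions; the values outside F are irrelevant. *)
definition A_fun :: "complex set \<Rightarrow> (complex \<Rightarrow> complex) set" where
  "A_fun F = {f. continuous_on F f \<and> f holomorphic_on interior F}"

end

theory Submission
  imports Defs
begin

text \<open>
  A continuous logarithm of a function holomorphic on an open set is holomorphic there
  (\<open>holomorphic_on_logarithm\<close>), so the theorem is a statement about continuous logarithms: the
  class \<open>A_fun F\<close> may be replaced by the continuous functions in one direction, and by the
  restrictions of entire functions in the other.

  \<^bold>\<open>Arakelian sets admit logarithms.\<close> By Borsuk's separation theorem every zero-free continuous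
  function on a compact plane set with connected complement has a continuous logarithm. If \<open>F\<close> has
  no holes, this applies to each \<open>F \<inter> cball 0 T\<close>, because all components of the complement of \<open>F\<close>
  reach the connected set outside the disc. The logarithms on larger and larger pieces must be made
  to converge, and this is where the second condition enters (\<open>change_log_outside_disc\<close>). Let
  \<open>D = cball 0 R\<close>, let \<open>S\<close> be so large that \<open>cball 0 S\<close> contains \<open>D\<close> and all holes of \<open>F \<union> D\<close>, and
  let \<open>g\<close> be a logarithm of \<open>f\<close> on \<open>F \<inter> cball 0 S\<close>. A continuous extension of \<open>g\<close> to the plane
  extends \<open>f\<close>, as the exponential of that extension, to \<open>D\<close> and to all holes of \<open>F \<union> D\<close> without
  zeros. On the filled set logarithms exist again, and on the connected set \<open>D\<close> they differ from
  the extended \<open>g\<close> by a constant only. Hence \<open>f\<close> has a logarithm on any \<open>F \<inter> cball 0 T\<close> that agrees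
  with \<open>g\<close> on \<open>F \<inter> D\<close>. Taking \<open>R = 0, 1, 2, ...\<close> yields a sequence of logarithms that is eventually
  constant on each bounded part of \<open>F\<close>.

  \<^bold>\<open>Logarithms force the Arakelian property.\<close> Let \<open>H\<close> be a bounded open set. A function with a
  single simple zero on the closure of \<open>H\<close>, lying in \<open>H\<close>, has no continuous logarithm on the frontier
  of \<open>H\<close> (\<open>no_log_on_frontier_around_simple_zero\<close>). So \<open>z - a\<close> rules out a hole of \<open>F\<close> at \<open>a\<close>. Now
  suppose that the holes of \<open>F \<union> D\<close>, where \<open>D = cball 0 R\<close>, are unbounded. Weierstrass' theorem gives
  an entire \<open>f\<close> with one simple zero \<open>a\<^sub>n\<close> in each of infinitely many holes \<open>C\<^sub>n\<close>, all zeros being far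
  from \<open>D\<close>. Let \<open>g\<close> be its logarithm on \<open>F\<close> and \<open>h\<close> one on a slightly larger disc. On the compact
  intersection \<open>g - h\<close> is continuous with values in \<open>2 \<pi> i \<int>\<close>, hence constant at scale \<open>e\<close> for some
  \<open>e > 0\<close>. If the part of the frontier of \<open>C\<^sub>n\<close> in \<open>D\<close> stays within \<open>e\<close> of \<open>F\<close>, then \<open>g\<close> and the
  correspondingly shifted \<open>h\<close> fit together to a logarithm of \<open>f\<close> on that frontier
  (\<open>glue_logs_across_disc\<close>), which is impossible. All other \<open>C\<^sub>n\<close> contain a disc of radius \<open>e / 4\<close>
  in a fixed bounded region; as the \<open>C\<^sub>n\<close> are disjoint, there are finitely many of them
  (\<open>finite_holes_far_from_set\<close>), a contradiction.
\<close>

section \<open>Continuous logarithms\<close>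

lemma exp_eq_1_near_0:
  fixes u :: complex
  assumes "exp u = 1" "norm u < 1"
  shows "u = 0"
proof -
  have "\<bar>Im u\<bar> < pi"
    using abs_Im_le_cmod[of u] assms(2) pi_gt3 by linarith
  then have "Ln (exp u) = u"
    by (intro Ln_exp) auto
  then show ?thesis using assms(1) by simp
qed

text \<open>
  The difference of two logarithms takes values in the discrete set \<open>2 \<pi> i \<int>\<close>, so it cannot vary
  on a connected set.
\<close>

lemma logarithms_differ_by_constant:
  fixes g h :: "'a::metric_space \<Rightarrow> complex"
  assumes "connected S" "continuous_on S g" "continuous_on S h"
    and "\<And>z. z \<in> S \<Longrightarrow> exp (g z) = exp (h z)"
  obtains c where "exp c = 1" "\<And>z. z \<in> S \<Longrightarrow> g z = h z + c"
proof (cases "S = {}")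
  case False
  then obtain p where p: "p \<in> S" by blast
  have exp1: "exp (g z - h z) = 1" if "z \<in> S" for z
    using assms(4)[OF that] by (simp add: exp_diff)
  have "(\<lambda>z. g z - h z) constant_on S"
  proof (rule continuous_discrete_range_constant[OF assms(1)])
    show "continuous_on S (\<lambda>z. g z - h z)"
      using assms by (intro continuous_intros)
    fix x assume x: "x \<in> S"
    have "1 \<le> norm ((g y - h y) - (g x - h x))"
      if "y \<in> S" "g y - h y \<noteq> g x - h x" for y
    proof (rule ccontr)
      assume "\<not> ?thesis"
      moreover have "exp ((g y - h y) - (g x - h x)) = 1"
        using exp1[OF x] exp1[OF \<open>y \<in> S\<close>] by (simp add: exp_diff)
      ultimately show False
        using exp_eq_1_near_0 that(2) by fastforce
    qed
    then show "\<exists>e>0. \<forall>y. y \<in> S \<and> g y - h y \<noteq> g x - h x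
                 \<longrightarrow> e \<le> norm ((g y - h y) - (g x - h x))"
      by (intro exI[of _ 1]) auto
  qed
  then obtain c where c: "\<And>z. z \<in> S \<Longrightarrow> g z - h z = c"
    unfolding constant_on_def by blast
  show ?thesis
  proof
    show "exp c = 1" using exp1[OF p] c[OF p] by simp
    show "g z = h z + c" if "z \<in> S" for z
      using c[OF that] by (simp add: algebra_simps)
  qed
qed (use that[of 0] in auto)

text \<open>
  Near \<open>z\<close> the increment of \<open>g\<close> is small, so that it is the principal logarithm of \<open>f w / f z\<close>.
\<close>

lemma holomorphic_on_logarithm:
  assumes "open S" "continuous_on S g" "f holomorphic_on S"
    and "\<And>z. z \<in> S \<Longrightarrow> exp (g z) = f z"
  shows "g holomorphic_on S"
proof -
  have "g field_differentiable at z" if z: "z \<in> S" for z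
  proof -
    have "isCont g z"
      using assms z continuous_on_eq_continuous_at by blast
    then obtain d where d: "d > 0" "\<And>w. dist w z < d \<Longrightarrow> dist (g w) (g z) < 1"
      unfolding continuous_at_eps_delta by (metis zero_less_one)
    obtain e where e: "e > 0" "ball z e \<subseteq> S"
      using assms(1) z open_contains_ball by blast
    define B where "B = ball z (min d e)"
    have B: "open B" "z \<in> B" "B \<subseteq> S"
      using d e by (auto simp: B_def)
    have Im: "\<bar>Im (g w - g z)\<bar> < pi / 2" if "w \<in> B" for w
    proof -
      have "norm (g w - g z) < 1"
        using d(2)[of w] that by (auto simp: B_def dist_norm norm_minus_commute)
      then show ?thesis using abs_Im_le_cmod[of "g w - g z"] pi_gt3 by linarith
    qed
    have quot: "exp (g w - g z) = f w / f z" if "w \<in> B" for w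
      using assms(4) that B z by (auto simp: exp_diff)
    have eq: "g z + Ln (f w / f z) = g w" if "w \<in> B" for w
    proof -
      have "- pi < Im (g w - g z) \<and> Im (g w - g z) \<le> pi"
        using Im[OF that] pi_gt_zero by linarith
      then have "Ln (exp (g w - g z)) = g w - g z"
        by (intro Ln_exp) auto
      then show ?thesis using quot[OF that] by simp
    qed
    have slit: "f w / f z \<notin> \<real>\<^sub>\<le>\<^sub>0" if "w \<in> B" for w
    proof -
      have "Re (exp (g w - g z)) > 0"
        unfolding Re_exp
        using Im[OF that] by (intro mult_pos_pos cos_gt_zero_pi) (auto simp: abs_less_iff simp del: minus_complex.sel)
      then show ?thesis
        unfolding quot[OF that] by (auto simp: complex_nonpos_Reals_iff)
    qed
    have "f z \<noteq> 0" using assms(4)[OF z] by (metis exp_not_eq_zero)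
    then have "(\<lambda>w. g z + Ln (f w / f z)) holomorphic_on B"
      using assms(3) B(3) slit
      by (intro holomorphic_intros) (auto intro: holomorphic_on_subset)
    then have "g holomorphic_on B"
      using eq by (rule holomorphic_transform)
    then show ?thesis
      using B holomorphic_on_imp_differentiable_at by blast
  qed
  then show ?thesis
    by (simp add: assms(1) field_differentiable_at_within holomorphic_on_def)
qed

text \<open>
  Along the circle such a logarithm would be \<open>ln r + \<i> t\<close> up to a constant, which gains \<open>2 \<pi> \<i>\<close> in
  one turn.
\<close>

lemma no_continuous_identity_log_on_circle:
  fixes a :: complex
  assumes "r > 0" "continuous_on (sphere a r) W"
    and "\<And>z. z \<in> sphere a r \<Longrightarrow> exp (W z) = z - a"
  shows False
proof -
  define \<gamma> where "\<gamma> = (\<lambda>t::real. a + of_real r * exp (\<i> * of_real t))"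
  have \<gamma>: "\<gamma> t \<in> sphere a r" for t
    using assms(1) by (simp add: \<gamma>_def dist_norm norm_mult)
  have "connected {0..2*pi}" by simp
  moreover have "continuous_on {0..2*pi} (\<lambda>t. W (\<gamma> t))"
    using \<gamma> by (intro continuous_on_compose2[OF assms(2)]) (auto simp: \<gamma>_def intro!: continuous_intros)
  moreover have "continuous_on {0..2*pi} (\<lambda>t. of_real (ln r) + \<i> * of_real t)"
    by (intro continuous_intros)
  moreover have "exp (W (\<gamma> t)) = exp (of_real (ln r) + \<i> * of_real t)" for t
    using assms(3)[OF \<gamma>] assms(1) by (simp add: \<gamma>_def exp_add exp_of_real)
  ultimately obtain c where
    c: "\<And>t. t \<in> {0..2*pi} \<Longrightarrow> W (\<gamma> t) = of_real (ln r) + \<i> * of_real t + c"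
    using logarithms_differ_by_constant by blast
  have "\<gamma> (2*pi) = \<gamma> 0"
    using exp_two_pi_i by (simp add: \<gamma>_def mult.commute mult.assoc)
  then show False
    using c[of 0] c[of "2*pi"] by simp
qed

lemma Tietze_compact:
  fixes g :: "'a::{metric_space,second_countable_topology} \<Rightarrow> 'b::real_inner"
  assumes "compact K" "continuous_on K g"
  obtains g' where "continuous_on UNIV g'" "\<And>z. z \<in> K \<Longrightarrow> g' z = g z"
proof -
  have "bounded (g ` K)"
    using compact_imp_bounded[OF compact_continuous_image[OF assms(2,1)]] .
  then obtain B where B: "B > 0" "\<And>z. z \<in> K \<Longrightarrow> norm (g z) \<le> B"
    unfolding bounded_pos by blast
  have "closedin (top_of_set UNIV) K"
    using compact_imp_closed[OF assms(1)] by simp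
  then show ?thesis
    using Tietze[OF assms(2), of UNIV B] B that by (metis less_imp_le)
qed

text \<open>
  If \<open>G\<close> existed, then \<open>v\<close> divided by the exponential of an extension of \<open>G\<close> would match the function
  \<open>1 / (z - a)\<close> along the frontier, and the two would form a zero-free continuous function on the
  plane. This has a logarithm, hence so does \<open>z - a\<close> on every circle around \<open>H\<close>.
\<close>

lemma no_log_on_frontier_of_linear_factor:
  fixes H :: "complex set"
  assumes "open H" "bounded H" "a \<in> H"
    and v: "continuous_on (closure H) v" "\<And>z. z \<in> closure H \<Longrightarrow> v z \<noteq> 0"
    and G: "continuous_on (frontier H) G" "\<And>z. z \<in> frontier H \<Longrightarrow> exp (G z) = (z - a) * v z"
  shows False
proof -
  have "compact (frontier H)"
    using assms(2) by (simp add: compact_frontier_bounded)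
  from Tietze_compact[OF this G(1)]
  obtain G' where G': "continuous_on UNIV G'" "\<And>z. z \<in> frontier H \<Longrightarrow> G' z = G z"
    by blast
  define w where "w = (\<lambda>z. if z \<in> closure H then v z * exp (- G' z) else inverse (z - a))"
  have "continuous_on (closure H \<union> - H) w"
    unfolding w_def
  proof (rule continuous_on_cases)
    show "closed (closure H)" "closed (- H)" using assms(1) by auto
    show "continuous_on (closure H) (\<lambda>z. v z * exp (- G' z))"
      using v(1) continuous_on_subset[OF G'(1)] by (intro continuous_intros) auto
    show "continuous_on (- H) (\<lambda>z. inverse (z - a))"
      using assms(3) by (intro continuous_intros) auto
    show "\<forall>z. z \<in> closure H \<and> z \<notin> closure H \<or> z \<in> - H \<and> z \<in> closure H
           \<longrightarrow> v z * exp (- G' z) = inverse (z - a)"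
    proof (intro allI impI)
      fix z assume "z \<in> closure H \<and> z \<notin> closure H \<or> z \<in> - H \<and> z \<in> closure H"
      then have z: "z \<in> frontier H"
        using assms(1) by (auto simp: frontier_def interior_open)
      then have "z \<noteq> a" "v z \<noteq> 0"
        using assms(1,3) v(2) by (auto simp: frontier_def interior_open)
      then show "v z * exp (- G' z) = inverse (z - a)"
        using G(2)[OF z] G'(2)[OF z] by (simp add: exp_minus divide_simps)
    qed
  qed
  moreover have "closure H \<union> - H = UNIV" using closure_subset by blast
  ultimately have "continuous_on UNIV w" by simp
  moreover have "contractible (UNIV :: complex set)" by simp
  moreover have "w z \<noteq> 0" for z
    using v(2) closure_subset assms(3) by (auto simp: w_def)
  ultimately obtain W where W: "continuous_on UNIV W" "\<And>z. w z = exp (W z)"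
    using continuous_logarithm_on_contractible by (metis UNIV_I)
  obtain r where r: "r > 0" "closure H \<subseteq> ball a r"
    using assms(2) by (meson bounded_closure bounded_subset_ballD)
  show False
  proof (rule no_continuous_identity_log_on_circle[OF r(1)])
    show "continuous_on (sphere a r) (\<lambda>z. - W z)"
      using continuous_on_subset[OF W(1)] by (intro continuous_intros) auto
    fix z assume "z \<in> sphere a r"
    then have "z \<notin> closure H" using r(2) by auto
    then show "exp (- W z) = z - a"
      using W(2)[of z] by (simp add: w_def exp_minus flip: W(2))
  qed
qed

section \<open>Logarithms on Arakelian sets\<close>

definition fill :: "complex set \<Rightarrow> complex set" where
  "fill E = E \<union> \<Union> (holes E)"

lemma Compl_fill: "- fill E = \<Union> {C \<in> components (- E). \<not> bounded C}"
proof (intro set_eqI iffI)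
  fix z assume z: "z \<in> - fill E"
  then have "z \<in> \<Union> (components (- E))"
    unfolding Union_components by (simp add: fill_def)
  then obtain C where C: "C \<in> components (- E)" "z \<in> C"
    by blast
  then show "z \<in> \<Union> {C \<in> components (- E). \<not> bounded C}"
    using z by (auto simp: fill_def holes_def)
next
  fix z assume "z \<in> \<Union> {C \<in> components (- E). \<not> bounded C}"
  then obtain C where C: "C \<in> components (- E)" "z \<in> C" "\<not> bounded C" by blast
  then have "z \<notin> E" using in_components_subset by blast
  moreover have "z \<notin> D" if "D \<in> holes E" for D
    using that C components_nonoverlap[of C "- E" D] by (auto simp: holes_def)
  ultimately show "z \<in> - fill E" by (auto simp: fill_def)
qed

lemma closed_fill:
  assumes "closed E"
  shows "closed (fill E)"
proof -
  have "open (- E)" using assms by auto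
  then have "\<forall>C \<in> {C \<in> components (- E). \<not> bounded C}. open C"
    using open_components by blast
  then show ?thesis
    unfolding closed_def Compl_fill by (rule open_Union)
qed

text \<open>
  All components of the complement of the filled set are unbounded, so each of them meets the
  connected set outside the disc.
\<close>

lemma connected_Compl_fill_Int_cball: "connected (- (fill E \<inter> cball 0 T))"
proof -
  have "connected (- cball (0::complex) T \<union> \<Union> {C \<in> components (- E). \<not> bounded C})"
  proof (rule connected_Un_UN)
    show "connected (- cball (0::complex) T)"
      by (intro connected_complement_bounded_convex) auto
    fix C assume C: "C \<in> {C \<in> components (- E). \<not> bounded C}"
    then show "connected C" using in_components_connected by blast
    show "- cball 0 T \<inter> C \<noteq> {}"
      using C bounded_subset[OF bounded_cball, of C 0 T] by auto
  qed
  then show ?thesis by (simp add: Compl_fill[symmetric] Un_commute)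
qed

lemma log_on_fill_Int_cball:
  fixes f :: "complex \<Rightarrow> complex"
  assumes "closed E" "continuous_on (fill E \<inter> cball 0 T) f"
    and "\<And>z. z \<in> fill E \<inter> cball 0 T \<Longrightarrow> f z \<noteq> 0"
  obtains g where "continuous_on (fill E \<inter> cball 0 T) g"
    "\<And>z. z \<in> fill E \<inter> cball 0 T \<Longrightarrow> exp (g z) = f z"
proof -
  have "compact (fill E \<inter> cball 0 T)"
    using closed_fill[OF assms(1)] by (intro closed_Int_compact) auto
  then have "Borsukian (fill E \<inter> cball 0 T)"
    using Borsukian_separation_compact connected_Compl_fill_Int_cball by blast
  moreover have "f \<in> (fill E \<inter> cball 0 T) \<rightarrow> - {0}"
    using assms(3) by auto
  ultimately obtain g where "continuous_on (fill E \<inter> cball 0 T) g"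
      "\<forall>z \<in> fill E \<inter> cball 0 T. f z = exp (g z)"
    using assms(2) unfolding Borsukian_continuous_logarithm by blast
  then show ?thesis using that[of g] by auto
qed

text \<open>
  A logarithm on \<open>F \<inter> cball 0 S\<close> need not extend to a larger part of \<open>F\<close>. It does so after it has
  been modified outside \<open>cball 0 R\<close>, provided that \<open>cball 0 S\<close> contains all holes that arise by adding
  \<open>cball 0 R\<close> to \<open>F\<close>. The reason is that \<open>f\<close> then extends without zeros to these holes, and the
  remaining freedom in the choice of a logarithm is a single constant.
\<close>

lemma change_log_outside_disc:
  fixes f g :: "complex \<Rightarrow> complex"
  assumes "closed F" "continuous_on F f" "\<And>z. z \<in> F \<Longrightarrow> f z \<noteq> 0"
    and S: "cball 0 R \<union> \<Union> (holes (F \<union> cball 0 R)) \<subseteq> cball 0 S"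
    and g: "continuous_on (F \<inter> cball 0 S) g" "\<And>z. z \<in> F \<inter> cball 0 S \<Longrightarrow> exp (g z) = f z"
  obtains g' where "continuous_on (F \<inter> cball 0 T) g'"
    "\<And>z. z \<in> F \<inter> cball 0 T \<Longrightarrow> exp (g' z) = f z"
    "\<And>z. z \<in> F \<inter> cball 0 R \<inter> cball 0 T \<Longrightarrow> g' z = g z"
proof -
  define E where "E = F \<union> cball 0 R"
  have "closed E" using assms(1) by (auto simp: E_def)
  have fillE: "fill E \<subseteq> F \<union> cball 0 S" "F \<subseteq> fill E" "cball 0 R \<subseteq> fill E"
    using S by (auto simp: fill_def E_def)
  have "compact (F \<inter> cball 0 S)"
    using assms(1) by (intro closed_Int_compact) auto
  from Tietze_compact[OF this g(1)]
  obtain G where G: "continuous_on UNIV G" "\<And>z. z \<in> F \<inter> cball 0 S \<Longrightarrow> G z = g z"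
    by blast
  define X where "X = fill E \<inter> cball 0 T"
  define f' where "f' = (\<lambda>z. if z \<in> F then f z else exp (G z))"
  \<comment> \<open>The two definitions agree on the overlap because \<open>exp (G z) = exp (g z) = f z\<close> there.\<close>
  have "continuous_on (F \<union> (fill E \<inter> cball 0 S)) f'"
    unfolding f'_def
  proof (rule continuous_on_cases)
    show "closed (fill E \<inter> cball 0 S)"
      using closed_fill[OF \<open>closed E\<close>] by auto
    show "continuous_on (fill E \<inter> cball 0 S) (\<lambda>z. exp (G z))"
      using continuous_on_subset[OF G(1)] by (intro continuous_intros) auto
  qed (use assms(1,2) G(2) g(2) in auto)
  then have "continuous_on X f'"
    by (rule continuous_on_subset) (use fillE in \<open>auto simp: X_def\<close>)
  moreover have "f' z \<noteq> 0" for z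
    using assms(3) by (auto simp: f'_def)
  ultimately obtain L where L: "continuous_on X L" "\<And>z. z \<in> X \<Longrightarrow> exp (L z) = f' z"
    using log_on_fill_Int_cball[OF \<open>closed E\<close>, of T f'] unfolding X_def by blast
  define D where "D = cball (0::complex) R \<inter> cball 0 T"
  have D: "D \<subseteq> X" "D \<subseteq> cball 0 S" using fillE S by (auto simp: D_def X_def)
  have "connected D" unfolding D_def by (intro convex_connected convex_Int) auto
  moreover have "continuous_on D L" "continuous_on D G"
    using L(1) G(1) D(1) by (auto intro: continuous_on_subset)
  moreover have "exp (L z) = exp (G z)" if "z \<in> D" for z
  proof -
    have "z \<in> X" "z \<in> cball 0 S" using D that by auto
    then show ?thesis
      using L(2)[of z] G(2)[of z] g(2)[of z] by (auto simp: f'_def)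
  qed
  ultimately obtain c where c: "exp c = 1" "\<And>z. z \<in> D \<Longrightarrow> L z = G z + c"
    using logarithms_differ_by_constant by blast
  have sub: "F \<inter> cball 0 T \<subseteq> X" using fillE by (auto simp: X_def)
  show ?thesis
  proof
    show "continuous_on (F \<inter> cball 0 T) (\<lambda>z. L z - c)"
      using continuous_on_subset[OF L(1) sub] by (intro continuous_intros)
    show "exp (L z - c) = f z" if "z \<in> F \<inter> cball 0 T" for z
      using L(2)[of z] sub that c(1) by (auto simp: exp_diff f'_def)
    show "L z - c = g z" if "z \<in> F \<inter> cball 0 R \<inter> cball 0 T" for z
    proof -
      have "z \<in> D" using that by (auto simp: D_def)
      then show ?thesis using c(2)[of z] G(2)[of z] D(2) that by auto
    qed
  qed
qed

text \<open>
  The radius \<open>s n\<close> is chosen so that a logarithm on \<open>F \<inter> cball 0 (s n)\<close> can be continued to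
  \<open>F \<inter> cball 0 (s (n + 1))\<close> without a change on \<open>F \<inter> cball 0 n\<close>.
\<close>

lemma arakelian_set_imp_log:
  fixes f :: "complex \<Rightarrow> complex"
  assumes "arakelian_set F" "continuous_on F f" "\<And>z. z \<in> F \<Longrightarrow> f z \<noteq> 0"
  obtains g where "continuous_on F g" "\<And>z. z \<in> F \<Longrightarrow> exp (g z) = f z"
proof -
  have "closed F" and fillF: "fill F = F"
    using assms(1) by (auto simp: arakelian_set_def fill_def)
  have "\<exists>s. cball 0 (real n) \<union> \<Union> (holes (F \<union> cball 0 (real n))) \<subseteq> cball 0 s" for n
  proof -
    have "bounded (\<Union> (holes (F \<union> cball 0 (real n))))"
      using assms(1) by (simp add: arakelian_set_def)
    then have "bounded (cball 0 (real n) \<union> \<Union> (holes (F \<union> cball 0 (real n))))"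
      by simp
    then show ?thesis unfolding bounded_iff by (metis mem_cball_0 subsetI)
  qed
  then obtain s where s:
    "\<And>n. cball 0 (real n) \<union> \<Union> (holes (F \<union> cball 0 (real n))) \<subseteq> cball 0 (s n)"
    by metis
  define P where "P = (\<lambda>n g. continuous_on (F \<inter> cball 0 (s n)) g \<and>
                          (\<forall>z \<in> F \<inter> cball 0 (s n). exp (g z) = f z))"
  define Q where "Q = (\<lambda>(n::nat) (g::complex \<Rightarrow> complex) g'.
                          \<forall>z \<in> F \<inter> cball 0 (real n). g' z = g z)"
  have "\<exists>L. \<forall>n. P n (L n) \<and> Q n (L n) (L (Suc n))"
  proof (rule dependent_nat_choice)
    obtain g where "continuous_on (fill F \<inter> cball 0 (s 0)) g"
        "\<And>z. z \<in> fill F \<inter> cball 0 (s 0) \<Longrightarrow> exp (g z) = f z"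
      using log_on_fill_Int_cball[OF \<open>closed F\<close>, of "s 0" f] continuous_on_subset[OF assms(2)]
        assms(3) fillF by (metis IntD1 inf_le1)
    then show "\<exists>g. P 0 g" unfolding P_def fillF by blast
  next
    fix g n assume g: "P n g"
    obtain g' where g': "continuous_on (F \<inter> cball 0 (s (Suc n))) g'"
      "\<And>z. z \<in> F \<inter> cball 0 (s (Suc n)) \<Longrightarrow> exp (g' z) = f z"
      "\<And>z. z \<in> F \<inter> cball 0 (real n) \<inter> cball 0 (s (Suc n)) \<Longrightarrow> g' z = g z"
      using g change_log_outside_disc[OF \<open>closed F\<close> assms(2,3) s, of n g "s (Suc n)"]
      unfolding P_def by blast
    have "cball 0 (real n) \<subseteq> cball (0::complex) (real (Suc n))" by auto
    also have "\<dots> \<subseteq> cball 0 (s (Suc n))" using s[of "Suc n"] by blast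
    finally have "Q n g g'" using g'(3) unfolding Q_def by blast
    then show "\<exists>g'. P (Suc n) g' \<and> Q n g g'" using g'(1,2) unfolding P_def by blast
  qed
  then obtain L where L: "\<And>n. P n (L n)" "\<And>n. Q n (L n) (L (Suc n))" by blast
  have L_eq: "L m z = L n z" if "n \<le> m" "z \<in> F \<inter> cball 0 (real n)" for m n z
    using that(1)
  proof (induction m rule: dec_induct)
    case (step m)
    have "z \<in> F \<inter> cball 0 (real m)" using that(2) step by auto
    then show ?case using L(2)[of m] step unfolding Q_def by simp
  qed simp
  define g where "g = (\<lambda>z. L (nat \<lceil>norm z\<rceil>) z)"
  have g_eq: "g z = L n z" if "z \<in> F \<inter> cball 0 (real n)" for z n
  proof -
    have "nat \<lceil>norm z\<rceil> \<le> n" "norm z \<le> real (nat \<lceil>norm z\<rceil>)"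
      using that by (auto simp: nat_le_iff ceiling_le_iff real_nat_ceiling_ge)
    then show ?thesis
      using L_eq[of "nat \<lceil>norm z\<rceil>" n z] that by (auto simp: g_def)
  qed
  have sub: "cball (0::complex) (real n) \<subseteq> cball 0 (s n)" for n using s by blast
  have Lc: "continuous_on (F \<inter> cball 0 (real n)) (L n)" for n
    using L(1)[of n] sub[of n] unfolding P_def by (blast intro: continuous_on_subset)
  show ?thesis
  proof
    show "exp (g z) = f z" if "z \<in> F" for z
    proof -
      have z: "z \<in> F \<inter> cball 0 (real (nat \<lceil>norm z\<rceil>))"
        using that by (auto simp: real_nat_ceiling_ge)
      then show ?thesis
        using L(1) sub unfolding P_def g_def by blast
    qed
    show "continuous_on F g"
      unfolding continuous_on_eq_continuous_within
    proof
      fix z assume z: "z \<in> F"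
      obtain n where n: "norm z < real n" using reals_Archimedean2 by blast
      have "continuous_on (F \<inter> cball 0 (real n)) g"
        using Lc[of n] g_eq by (subst continuous_on_cong) auto
      then have "continuous (at z within F \<inter> cball 0 (real n)) g"
        using z n by (auto simp: continuous_on_eq_continuous_within)
      moreover have "at z within F \<inter> cball 0 (real n) = at z within F"
        using n by (intro at_within_nhd[of z "ball 0 (real n)"]) auto
      ultimately show "continuous (at z within F) g" by simp
    qed
  qed
qed

section \<open>Holes of the union with a disc\<close>

text \<open>
  This makes it possible to replace the compact set in the definition of an Arakelian set by a disc:
  enlarging the set may split a hole, but what remains of the hole is still covered by holes.
\<close>

lemma holes_outside_larger_set:
  assumes "K \<subseteq> K'"
  shows "\<Union> (holes (F \<union> K)) - (F \<union> K') \<subseteq> \<Union> (holes (F \<union> K'))"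
proof
  fix z assume z: "z \<in> \<Union> (holes (F \<union> K)) - (F \<union> K')"
  then obtain H where H: "H \<in> components (- (F \<union> K))" "bounded H" "z \<in> H"
    by (auto simp: holes_def)
  define C where "C = connected_component_set (- (F \<union> K')) z"
  have C: "C \<in> components (- (F \<union> K'))" "z \<in> C"
    using z by (auto simp: C_def components_def)
  have "C \<subseteq> - (F \<union> K)"
    using in_components_subset[OF C(1)] assms by auto
  then have "C \<subseteq> H"
    using components_maximal[OF H(1), of C] C in_components_connected[OF C(1)] H(3) by blast
  then have "C \<in> holes (F \<union> K')"
    using C H(2) bounded_subset by (auto simp: holes_def)
  then show "z \<in> \<Union> (holes (F \<union> K'))" using C by blast
qed

text \<open>
  Let the closure of \<open>H\<close> touch the disc at a point \<open>p\<close> with distance at least \<open>e\<close> from \<open>F\<close>. From a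
  point of \<open>H\<close> close to \<open>p\<close>, moving radially away from the origin by \<open>e / 4\<close> leads to the centre
  of a disc of radius \<open>e / 4\<close> that avoids both \<open>F\<close> and \<open>cball 0 R\<close> and so lies in \<open>H\<close>. Only finitely
  many disjoint sets can contain such discs in a bounded region.
\<close>

lemma finite_holes_far_from_set:
  fixes F :: "complex set"
  assumes "e > 0"
  shows "finite {H \<in> components (- (F \<union> cball 0 R)).
                   \<exists>p \<in> closure H \<inter> cball 0 R. \<forall>w\<in>F. e \<le> dist p w}" (is "finite ?\<B>")
proof -
  have "\<exists>q. cball q (e/4) \<subseteq> H \<and> norm q \<le> R + e" if HB: "H \<in> ?\<B>" for H
  proof -
    obtain p where p: "p \<in> closure H" "norm p \<le> R" "\<And>w. w \<in> F \<Longrightarrow> e \<le> dist p w"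
      using HB unfolding mem_Collect_eq Bex_def Int_iff mem_cball_0 by blast
    obtain z where z: "z \<in> H" "dist z p < e/4"
      using p(1) assms unfolding closure_approachable by (metis divide_pos_pos zero_less_numeral)
    have H: "H \<in> components (- (F \<union> cball 0 R))" using HB by blast
    then have "norm z > R" using z(1) in_components_subset by fastforce
    have "R \<ge> 0" using p(2) norm_ge_zero order_trans by blast
    define q where "q = z + (e/4) *\<^sub>R sgn z"
    have "z \<noteq> 0" using \<open>R \<ge> 0\<close> \<open>norm z > R\<close> by auto
    have dq: "dist z q = e/4"
      using assms \<open>z \<noteq> 0\<close> by (simp add: q_def dist_norm norm_sgn)
    have "q = (1 + (e/4) / norm z) *\<^sub>R z"
      by (simp add: q_def sgn_div_norm scaleR_add_left field_simps)
    then have nq: "norm q = norm z + e/4"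
      using assms \<open>z \<noteq> 0\<close> by (simp add: field_simps abs_of_pos add_pos_pos)
    have "cball q (e/4) \<subseteq> - (F \<union> cball 0 R)"
    proof
      fix y assume y: "y \<in> cball q (e/4)"
      have "norm q \<le> norm y + dist q y"
        using norm_triangle_ineq2[of q y] by (simp add: dist_norm)
      then have "norm y > R" using y nq \<open>norm z > R\<close> by simp
      moreover have "dist p y < e"
        using assms y z(2) dq dist_triangle[of p y z] dist_triangle[of z y q]
        by (simp add: dist_commute)
      ultimately show "y \<in> - (F \<union> cball 0 R)" using p(3)[of y] by auto
    qed
    moreover have "z \<in> cball q (e/4)" using dq by (simp add: dist_commute)
    ultimately have "cball q (e/4) \<subseteq> H"
      using components_maximal[OF H connected_cball] z(1) by blast
    moreover have "norm z \<le> norm p + dist z p"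
      using norm_triangle_ineq2[of z p] by (simp add: dist_norm)
    ultimately show ?thesis using nq p(2) z(2) assms by (intro exI[of _ q]) auto
  qed
  then have "\<forall>H \<in> ?\<B>. \<exists>q. cball q (e/4) \<subseteq> H \<and> norm q \<le> R + e"
    by blast
  from bchoice[OF this] obtain q where
    q': "\<forall>H \<in> ?\<B>. cball (q H) (e/4) \<subseteq> H \<and> norm (q H) \<le> R + e" ..
  have q: "cball (q H) (e/4) \<subseteq> H" "norm (q H) \<le> R + e" if "H \<in> ?\<B>" for H
    using bspec[OF q' that] by auto
  have sep: "H = H'" if "H \<in> ?\<B>" "H' \<in> ?\<B>" "dist (q H) (q H') < e/4" for H H'
  proof -
    have "q H' \<in> H" "q H' \<in> H'"
      using q(1)[OF that(1)] q(1)[OF that(2)] that(3) assms by (auto simp: subset_iff)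
    then show ?thesis using that components_nonoverlap by blast
  qed
  have "inj_on q ?\<B>"
  proof (rule inj_onI)
    fix H H' assume "H \<in> ?\<B>" "H' \<in> ?\<B>" "q H = q H'"
    then show "H = H'" using sep[of H H'] assms by simp
  qed
  moreover have "finite (q ` ?\<B>)"
  proof (rule ccontr)
    assume "infinite (q ` ?\<B>)"
    moreover have "bounded (q ` ?\<B>)" using q(2) unfolding bounded_iff by blast
    ultimately obtain x where x: "x islimpt (q ` ?\<B>)"
      using bounded_infinite_imp_islimpt by blast
    have lim: "\<exists>H \<in> ?\<B>. q H \<noteq> x \<and> dist (q H) x < \<epsilon>" if "\<epsilon> > 0" for \<epsilon>
      using x that unfolding islimpt_approachable by blast
    obtain H where H: "H \<in> ?\<B>" "q H \<noteq> x" "dist (q H) x < e/8"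
      using lim[of "e/8"] assms by auto
    obtain H' where H': "H' \<in> ?\<B>" "q H' \<noteq> x" "dist (q H') x < min (e/8) (dist (q H) x)"
      using lim[of "min (e/8) (dist (q H) x)"] assms H(2) by auto
    have "dist (q H) (q H') < e/4"
      using H(3) H'(3) dist_triangle2[of "q H" "q H'" x] by simp
    then show False using sep[OF H(1) H'(1)] H'(3) by auto
  qed
  ultimately show ?thesis using finite_image_iff by blast
qed

text \<open>
  The difference \<open>k\<close> of the two logarithms is uniformly continuous on \<open>F \<inter> cball 0 (R + 1)\<close> and takes
  discrete values, so it is constant at a scale \<open>d\<close>. A point of the disc that is close to \<open>F\<close> inherits
  the value of \<open>k\<close> from any nearby point of \<open>F\<close>, and \<open>h\<close> plus this inherited value is a logarithm that
  continues \<open>g\<close>. The margin \<open>R + 1\<close> is there because the nearby point of \<open>F\<close> may lie outside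
  \<open>cball 0 R\<close>.
\<close>

lemma glue_logs_across_disc:
  fixes f g h :: "complex \<Rightarrow> complex"
  assumes "closed F" "continuous_on F g" "continuous_on (cball 0 (R + 1)) h"
    and g: "\<And>z. z \<in> F \<Longrightarrow> exp (g z) = f z"
    and h: "\<And>z. z \<in> cball 0 (R + 1) \<Longrightarrow> exp (h z) = f z"
  obtains e where "e > 0"
    "\<And>X. closed X \<Longrightarrow> X \<subseteq> F \<union> cball 0 R \<Longrightarrow> (\<And>z. z \<in> X \<inter> cball 0 R \<Longrightarrow> \<exists>w\<in>F. dist z w < e)
      \<Longrightarrow> \<exists>G. continuous_on X G \<and> (\<forall>z \<in> X. exp (G z) = f z)"
proof -
  define k where "k = (\<lambda>z. g z - h z)"
  have "compact (F \<inter> cball 0 (R + 1))"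
    using assms(1) by (intro closed_Int_compact) auto
  moreover have "continuous_on (F \<inter> cball 0 (R + 1)) k"
    unfolding k_def using assms(2,3) by (intro continuous_intros) (auto intro: continuous_on_subset)
  ultimately have "uniformly_continuous_on (F \<inter> cball 0 (R + 1)) k"
    by (rule compact_uniformly_continuous[rotated])
  then obtain d where d: "d > 0"
    "\<And>z w. z \<in> F \<inter> cball 0 (R + 1) \<Longrightarrow> w \<in> F \<inter> cball 0 (R + 1) \<Longrightarrow> dist w z < d \<Longrightarrow> dist (k w) (k z) < 1"
    unfolding uniformly_continuous_on_def by (metis zero_less_one)
  have exp_k: "exp (k z) = 1" if "z \<in> F \<inter> cball 0 (R + 1)" for z
    using g[of z] h[of z] that by (simp add: k_def exp_diff flip: g)
  have k_eq: "k w = k z"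
    if "z \<in> F \<inter> cball 0 (R + 1)" "w \<in> F \<inter> cball 0 (R + 1)" "dist w z < d" for z w
    using exp_eq_1_near_0[of "k w - k z"] d(2)[OF that] exp_k[OF that(1)] exp_k[OF that(2)]
    by (simp add: exp_diff dist_norm)
  \<comment> \<open>If two points of \<open>cball 0 R\<close> have distance below \<open>e\<close>, then points of \<open>F\<close> within \<open>e\<close> of them have distance
     below \<open>3 * e\<close>; the bound \<open>1\<close> keeps such points of \<open>F\<close> inside \<open>cball 0 (R + 1)\<close>.\<close>
  define e where "e = min (d / 3) 1"
  have e: "e > 0" "e \<le> 1" "3 * e \<le> d" using d(1) by (auto simp: e_def)
  have "\<exists>G. continuous_on X G \<and> (\<forall>z \<in> X. exp (G z) = f z)"
    if X: "closed X" "X \<subseteq> F \<union> cball 0 R" and near: "\<And>z. z \<in> X \<inter> cball 0 R \<Longrightarrow> \<exists>w\<in>F. dist z w < e" for X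
  proof -
    obtain w where w: "\<And>z. z \<in> X \<inter> cball 0 R \<Longrightarrow> w z \<in> F \<and> dist z (w z) < e"
      using near by metis
    have w_mem: "w z \<in> F \<inter> cball 0 (R + 1)" if "z \<in> X \<inter> cball 0 R" for z
      using w[OF that] that e(2) norm_triangle_ineq2[of "w z" z] by (auto simp: dist_norm norm_minus_commute)
    have kw_const: "k (w z) = k (w y)" if "z \<in> X \<inter> cball 0 R" "y \<in> X \<inter> cball 0 R" "dist z y < e" for z y
    proof (rule k_eq[OF w_mem[OF that(2)] w_mem[OF that(1)]])
      have "dist (w z) (w y) \<le> dist z (w z) + dist z y + dist y (w y)"
        using dist_triangle[of "w z" "w y" z] dist_triangle[of z "w y" y] by (simp add: dist_commute)
      then show "dist (w z) (w y) < d"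
        using w[OF that(1)] w[OF that(2)] that(3) e(3) by linarith
    qed
    have "continuous_on (X \<inter> cball 0 R) (\<lambda>z. k (w z))"
      unfolding continuous_on_iff
    proof (intro ballI allI impI)
      fix z and \<epsilon> :: real assume z: "z \<in> X \<inter> cball 0 R" and "\<epsilon> > 0"
      then have "dist (k (w y)) (k (w z)) < \<epsilon>" if "y \<in> X \<inter> cball 0 R" "dist y z < e" for y
        using kw_const[OF that(1) z that(2)] by simp
      then show "\<exists>\<delta>>0. \<forall>y\<in>X \<inter> cball 0 R. dist y z < \<delta> \<longrightarrow> dist (k (w y)) (k (w z)) < \<epsilon>"
        using e(1) by blast
    qed
    moreover have "continuous_on (X \<inter> cball 0 R) h"
      using assms(3) by (rule continuous_on_subset) auto
    ultimately have hk: "continuous_on (X \<inter> cball 0 R) (\<lambda>z. h z + k (w z))"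
      by (intro continuous_intros)
    define G where "G = (\<lambda>z. if z \<in> F then g z else h z + k (w z))"
    have "continuous_on ((F \<inter> X) \<union> (X \<inter> cball 0 R)) G"
      unfolding G_def
    proof (rule continuous_on_cases)
      show "continuous_on (F \<inter> X) g" using assms(2) by (rule continuous_on_subset) auto
      show "\<forall>z. z \<in> F \<inter> X \<and> z \<notin> F \<or> z \<in> X \<inter> cball 0 R \<and> z \<in> F \<longrightarrow> g z = h z + k (w z)"
      proof (intro allI impI)
        fix z assume "z \<in> F \<inter> X \<and> z \<notin> F \<or> z \<in> X \<inter> cball 0 R \<and> z \<in> F"
        then have z: "z \<in> X \<inter> cball 0 R" "z \<in> F" by auto
        have "dist (w z) z < d" using w[OF z(1)] e by (simp add: dist_commute)
        then have "k (w z) = k z" using z by (intro k_eq w_mem) auto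
        then show "g z = h z + k (w z)" by (simp add: k_def)
      qed
    qed (use assms(1) X(1) hk in auto)
    moreover have "(F \<inter> X) \<union> (X \<inter> cball 0 R) = X" using X(2) by blast
    moreover have "exp (G z) = f z" if "z \<in> X" for z
    proof (cases "z \<in> F")
      case False
      then have z: "z \<in> X \<inter> cball 0 R" using that X(2) by auto
      then show ?thesis
        using False h[of z] exp_k[OF w_mem[OF z]] by (simp add: G_def exp_add)
    qed (simp add: G_def g)
    ultimately show ?thesis by auto
  qed
  then show ?thesis using that e(1) by blast
qed

section \<open>Functions whose logarithms detect holes\<close>

lemma entire_with_simple_zeros:
  fixes a :: "nat \<Rightarrow> complex"
  assumes "inj a" "\<And>n. a n \<noteq> 0" "filterlim a at_infinity sequentially"
  obtains f where "f holomorphic_on UNIV" "\<And>z. f z = 0 \<longleftrightarrow> z \<in> range a"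
    "\<And>n. deriv f (a n) \<noteq> 0"
proof -
  have vim: "a -` {a n} = {n}" for n
    using assms(1) by (auto dest: injD)
  interpret weierstrass_product' a
    by standard (use assms vim in auto)
  show ?thesis
  proof
    show "f holomorphic_on UNIV" by (rule holomorphic)
    show "f z = 0 \<longleftrightarrow> z \<in> range a" for z by (rule zero)
    show "deriv f (a n) \<noteq> 0" for n
    proof -
      have nz: "\<exists>w\<in>UNIV. f w \<noteq> 0"
        using zero[of 0] assms(2) by (metis UNIV_I rangeE)
      have z1: "zorder f (a n) = 1"
        using zorder[of "a n"] vim[of n] by simp
      obtain r where r: "r > 0" "zor_poly f (a n) holomorphic_on cball (a n) r"
          "\<And>w. w \<in> cball (a n) r \<Longrightarrow> f w = zor_poly f (a n) w * (w - a n) \<and> zor_poly f (a n) w \<noteq> 0"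
        using zorder_exist_zero[OF holomorphic[of UNIV] open_UNIV connected_UNIV UNIV_I nz, of "a n"] z1
        by auto
      define p where "p = zor_poly f (a n)"
      have "p holomorphic_on ball (a n) r"
        using r(2) holomorphic_on_subset ball_subset_cball unfolding p_def by blast
      then have "(p has_field_derivative deriv p (a n)) (at (a n))"
        using r(1) by (intro holomorphic_derivI[of p "ball (a n) r"]) auto
      then have "((\<lambda>w. p w * (w - a n)) has_field_derivative p (a n)) (at (a n))"
        by (auto intro!: derivative_eq_intros)
      then have "(f has_field_derivative p (a n)) (at (a n))"
      proof (rule has_field_derivative_transform_within_open)
        show "p w * (w - a n) = f w" if "w \<in> ball (a n) r" for w
          using r(3)[of w] that by (simp add: p_def)
      qed (use r(1) in auto)
      moreover have "p (a n) \<noteq> 0" using r(1,3) by (simp add: p_def)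
      ultimately show ?thesis by (simp add: DERIV_imp_deriv)
    qed
  qed
qed

text \<open>
  The linear factor of \<open>f\<close> at \<open>a\<close> is split off; the cofactor has the value \<open>deriv f a\<close> at \<open>a\<close>.
\<close>

lemma no_log_on_frontier_around_simple_zero:
  assumes "open H" "bounded H" "a \<in> H"
    and f: "f holomorphic_on UNIV" "f a = 0" "deriv f a \<noteq> 0"
    and nz: "\<And>z. z \<in> closure H - {a} \<Longrightarrow> f z \<noteq> 0"
    and G: "continuous_on (frontier H) G" "\<And>z. z \<in> frontier H \<Longrightarrow> exp (G z) = f z"
  shows False
proof -
  define v where "v = (\<lambda>z. if z = a then deriv f a else (f z - f a) / (z - a))"
  have "v holomorphic_on UNIV"
    unfolding v_def using f(1) by (intro pole_lemma_open) auto
  then have "continuous_on (closure H) v"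
    by (meson continuous_on_subset holomorphic_on_imp_continuous_on subset_UNIV)
  moreover have "v z \<noteq> 0" if "z \<in> closure H" for z
    using nz[of z] f that by (auto simp: v_def)
  moreover have "exp (G z) = (z - a) * v z" if "z \<in> frontier H" for z
    using G(2)[OF that] f(2) by (auto simp: v_def)
  ultimately show False
    using no_log_on_frontier_of_linear_factor[OF assms(1-3) _ _ G(1)] by blast
qed

text \<open>
  Each new point is chosen farther from the origin than every point of the previous set. The norms
  of the points increase, so a point lies in none of the earlier sets.
\<close>

lemma distant_points_in_distinct_bounded_sets:
  fixes \<C> :: "'a::real_normed_vector set set"
  assumes "\<And>C. C \<in> \<C> \<Longrightarrow> bounded C" "\<not> bounded (\<Union> \<C>)"
  shows "\<exists>C a. (\<forall>n. C n \<in> \<C> \<and> a n \<in> C n \<and> norm (a n) > r + real n) \<and> inj C \<and> inj a"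
proof -
  define P where "P = (\<lambda>(n::nat) (x :: 'a \<times> 'a set).
                          snd x \<in> \<C> \<and> fst x \<in> snd x \<and> norm (fst x) > r + real n)"
  define Q where "Q = (\<lambda>(n::nat) (x :: 'a \<times> 'a set) (y :: 'a \<times> 'a set).
                          \<forall>z \<in> snd x. norm z < norm (fst y))"
  have far: "\<exists>C \<in> \<C>. \<exists>z \<in> C. norm z > b" for b
    using assms(2) unfolding bounded_iff by (meson UnionE not_le)
  have "\<exists>x. \<forall>n. P n (x n) \<and> Q n (x n) (x (Suc n))"
  proof (rule dependent_nat_choice)
    show "\<exists>x. P 0 x"
      using far[of r] unfolding P_def by auto
  next
    fix x n assume "P n x"
    then have "bounded (snd x)" using assms(1) by (auto simp: P_def)
    then obtain b where b: "\<And>z. z \<in> snd x \<Longrightarrow> norm z \<le> b" by (auto simp: bounded_iff)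
    obtain C z where "C \<in> \<C>" "z \<in> C" "norm z > max b (r + real (Suc n))"
      using far by blast
    then show "\<exists>y. P (Suc n) y \<and> Q n x y"
      using b by (intro exI[of _ "(z, C)"]) (fastforce simp: P_def Q_def)
  qed
  then obtain x where x: "\<And>n. P n (x n)" "\<And>n. Q n (x n) (x (Suc n))" by blast
  define a where "a = (\<lambda>n. fst (x n))"
  define C where "C = (\<lambda>n. snd (x n))"
  have C: "C n \<in> \<C>" "a n \<in> C n" "norm (a n) > r + real n" for n
    using x(1)[of n] by (auto simp: P_def a_def C_def)
  have step: "norm z < norm (a (Suc n))" if "z \<in> C n" for z n
    using x(2)[of n] that by (auto simp: Q_def a_def C_def)
  have "strict_mono (\<lambda>n. norm (a n))"
    using step C(2) by (intro strict_monoI_Suc) blast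
  then have mono: "norm (a m) \<le> norm (a n)" if "m \<le> n" for m n
    using that strict_mono_mono monoD by blast
  have notin: "a n \<notin> C m" if "m < n" for m n
    using step[of "a n" m] mono[of "Suc m" n] that by auto
  have neq: "C m \<noteq> C n \<and> a m \<noteq> a n" if "m < n" for m n
    using notin[OF that] C(2) by metis
  have "inj C" "inj a"
    using neq by (auto intro!: linorder_injI)
  then show ?thesis using C by blast
qed

section \<open>Logarithms force the Arakelian property\<close>

lemma log_imp_no_holes:
  assumes "closed F"
    and logs: "\<And>f. f holomorphic_on UNIV \<Longrightarrow> (\<And>z. z \<in> F \<Longrightarrow> f z \<noteq> 0)
                \<Longrightarrow> \<exists>g. continuous_on F g \<and> (\<forall>z \<in> F. exp (g z) = f z)"
  shows "holes F = {}"
proof (rule ccontr)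
  assume "holes F \<noteq> {}"
  then obtain H where H: "H \<in> components (- F)" "bounded H" by (auto simp: holes_def)
  then obtain a where a: "a \<in> H" using in_components_nonempty by blast
  then have "a \<notin> F" using H(1) in_components_subset by blast
  have frontier: "frontier H \<subseteq> F" using frontier_of_components_closed_complement assms(1) H(1) by blast
  have "\<exists>g. continuous_on F g \<and> (\<forall>z \<in> F. exp (g z) = z - a)"
    using \<open>a \<notin> F\<close> by (intro logs holomorphic_intros) auto
  then obtain g where g: "continuous_on F g" "\<And>z. z \<in> F \<Longrightarrow> exp (g z) = z - a" by blast
  show False
  proof (rule no_log_on_frontier_of_linear_factor[where v = "\<lambda>_. 1"])
    show "open H" using H(1) assms(1) open_components by blast
    show "continuous_on (frontier H) g" using g(1) frontier continuous_on_subset by blast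
    show "exp (g z) = (z - a) * 1" if "z \<in> frontier H" for z
      using g(2) frontier that by auto
  qed (use H a in auto)
qed

text \<open>
  If the holes were unbounded, infinitely many of them could be given a simple zero of one entire
  function. Its logarithms on \<open>F\<close> and on the disc fit together along the frontier of all but finitely
  many of these holes, although the zero inside prevents this.
\<close>

lemma log_imp_bounded_holes:
  assumes "closed F"
    and logs: "\<And>f. f holomorphic_on UNIV \<Longrightarrow> (\<And>z. z \<in> F \<Longrightarrow> f z \<noteq> 0)
                \<Longrightarrow> \<exists>g. continuous_on F g \<and> (\<forall>z \<in> F. exp (g z) = f z)"
    and "0 \<le> R"
  shows "bounded (\<Union> (holes (F \<union> cball 0 R)))"
proof (rule ccontr)
  assume unb: "\<not> bounded (\<Union> (holes (F \<union> cball 0 R)))"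
  define E where "E = F \<union> cball 0 R"
  have "closed E" using assms(1) by (auto simp: E_def)
  \<comment> \<open>The zeros \<open>a n\<close> stay outside \<open>cball 0 (R + 1)\<close>, so that \<open>f\<close> has a logarithm on it.\<close>
  have "\<And>C. C \<in> holes E \<Longrightarrow> bounded C"
    by (auto simp: holes_def)
  moreover have "\<not> bounded (\<Union> (holes E))" using unb by (simp only: E_def not_False_eq_True)
  ultimately have "\<exists>C a. (\<forall>n. C n \<in> holes E \<and> a n \<in> C n \<and> norm (a n) > (R + 1) + real n)
      \<and> inj C \<and> inj a"
    by (rule distant_points_in_distinct_bounded_sets)
  then obtain C a where C: "\<And>n. C n \<in> holes E" and a: "\<And>n. a n \<in> C n"
      "\<And>n. norm (a n) > (R + 1) + real n" and "inj C" "inj a"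
    by blast
  have "C n \<in> components (- E)" "bounded (C n)" for n
    using C[of n] by (auto simp: holes_def)
  moreover have "open (C n)" for n
    using calculation(1) \<open>closed E\<close> open_components open_Compl by blast
  ultimately have comp: "C n \<in> components (- E)" "bounded (C n)" "open (C n)" for n
    by auto
  have aE: "a n \<notin> E" for n
    using a(1) comp(1) in_components_subset by blast
  have far: "norm (a n) > R + 1" for n
    using a(2)[of n] by simp
  have "filterlim (\<lambda>n. norm (a n)) at_top sequentially"
  proof (rule filterlim_at_top_mono[OF filterlim_real_sequentially])
    show "\<forall>\<^sub>F n in sequentially. real n \<le> norm (a n)"
      using a(2) assms(3) by (intro always_eventually allI) (smt (verit))
  qed
  then have "filterlim a at_infinity sequentially"
    by (simp add: filterlim_at_infinity_conv_norm_at_top)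
  moreover have "a n \<noteq> 0" for n using far[of n] assms(3) by auto
  ultimately obtain f where f: "f holomorphic_on UNIV" "\<And>z. f z = 0 \<longleftrightarrow> z \<in> range a"
      "\<And>n. deriv f (a n) \<noteq> 0"
    using entire_with_simple_zeros \<open>inj a\<close> by blast
  have "f z \<noteq> 0" if "z \<in> F" for z
    using f(2)[of z] aE that by (auto simp: E_def)
  then obtain g where g: "continuous_on F g" "\<And>z. z \<in> F \<Longrightarrow> exp (g z) = f z"
    using logs[OF f(1)] by blast
  have "f z \<noteq> 0" if "z \<in> cball 0 (R + 1)" for z
    using f(2)[of z] far that by (auto simp: not_le[symmetric])
  moreover have "continuous_on (cball 0 (R + 1)) f"
    using f(1) by (meson continuous_on_subset holomorphic_on_imp_continuous_on subset_UNIV)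
  ultimately obtain h where h: "continuous_on (cball 0 (R + 1)) h"
      "\<And>z. z \<in> cball 0 (R + 1) \<Longrightarrow> f z = exp (h z)"
    using continuous_logarithm_on_cball by blast
  obtain e where e: "e > 0"
    "\<And>X. closed X \<Longrightarrow> X \<subseteq> F \<union> cball 0 R \<Longrightarrow> (\<And>z. z \<in> X \<inter> cball 0 R \<Longrightarrow> \<exists>w\<in>F. dist z w < e)
      \<Longrightarrow> \<exists>G. continuous_on X G \<and> (\<forall>z \<in> X. exp (G z) = f z)"
    using glue_logs_across_disc[OF assms(1) g(1) h(1), of f] g(2) h(2) by metis
  have "infinite (range C)" using \<open>inj C\<close> range_inj_infinite by blast
  then obtain n where n:
    "\<not> (\<exists>p \<in> closure (C n) \<inter> cball 0 R. \<forall>w\<in>F. e \<le> dist p w)"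
    using finite_subset[OF _ finite_holes_far_from_set[OF e(1), of F R], of "range C"] comp(1)
    unfolding E_def by blast
  have frontier: "frontier (C n) \<subseteq> E"
    using frontier_of_components_closed_complement[OF \<open>closed E\<close> comp(1)] .
  have "\<exists>w\<in>F. dist z w < e" if "z \<in> frontier (C n) \<inter> cball 0 R" for z
    using n that unfolding frontier_def by (meson DiffD1 IntD1 IntD2 IntI not_le)
  then obtain G where G: "continuous_on (frontier (C n)) G"
      "\<And>z. z \<in> frontier (C n) \<Longrightarrow> exp (G z) = f z"
    using e(2)[of "frontier (C n)"] frontier unfolding E_def by blast
  show False
  proof (rule no_log_on_frontier_around_simple_zero[OF comp(3,2) a(1) f(1) _ f(3) _ G])
    show "f (a n) = 0" using f(2) by blast
    show "f z \<noteq> 0" if z: "z \<in> closure (C n) - {a n}" for z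
    proof
      assume "f z = 0"
      then obtain m where m: "z = a m" using f(2) by blast
      then have "m \<noteq> n" using z by auto
      then have "C m \<inter> C n = {}"
        using components_nonoverlap[OF comp(1) comp(1), of m n] \<open>inj C\<close> by (auto dest: injD)
      then have "C m \<inter> closure (C n) = {}"
        using open_Int_closure_eq_empty[OF comp(3)] by blast
      then show False using m z a(1)[of m] by blast
    qed
  qed
qed

section \<open>The characterisation of Arakelian sets\<close>

theorem theorem2:
  fixes F :: "complex set"
  assumes "closed F"
  shows "arakelian_set F \<longleftrightarrow>
    (\<forall>f \<in> A_fun F. (\<forall>z \<in> F. f z \<noteq> 0) \<longrightarrow>
       (\<exists>g \<in> A_fun F. \<forall>z \<in> F. exp (g z) = f z))"
proof
  assume ara: "arakelian_set F"
  show "\<forall>f \<in> A_fun F. (\<forall>z \<in> F. f z \<noteq> 0) \<longrightarrow> (\<exists>g \<in> A_fun F. \<forall>z \<in> F. exp (g z) = f z)"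
  proof (intro ballI impI)
    fix f assume f: "f \<in> A_fun F" "\<forall>z \<in> F. f z \<noteq> 0"
    then obtain g where g: "continuous_on F g" "\<And>z. z \<in> F \<Longrightarrow> exp (g z) = f z"
      using arakelian_set_imp_log[OF ara, of f] by (auto simp: A_fun_def)
    have "g holomorphic_on interior F"
    proof (rule holomorphic_on_logarithm)
      show "continuous_on (interior F) g"
        using g(1) interior_subset continuous_on_subset by blast
      show "f holomorphic_on interior F" using f(1) by (simp add: A_fun_def)
      show "exp (g z) = f z" if "z \<in> interior F" for z
        using g(2) interior_subset that by blast
    qed simp
    then show "\<exists>g \<in> A_fun F. \<forall>z \<in> F. exp (g z) = f z"
      using g by (auto simp: A_fun_def)
  qed
next
  assume logs: "\<forall>f \<in> A_fun F. (\<forall>z \<in> F. f z \<noteq> 0) \<longrightarrow> (\<exists>g \<in> A_fun F. \<forall>z \<in> F. exp (g z) = f z)"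
  have entire: "\<exists>g. continuous_on F g \<and> (\<forall>z \<in> F. exp (g z) = f z)"
    if "f holomorphic_on UNIV" "\<And>z. z \<in> F \<Longrightarrow> f z \<noteq> 0" for f
  proof -
    have "f \<in> A_fun F"
      using that(1) holomorphic_on_imp_continuous_on unfolding A_fun_def
      by (blast intro: continuous_on_subset holomorphic_on_subset)
    then show ?thesis using logs that(2) by (auto simp: A_fun_def)
  qed
  have "bounded (\<Union> (holes (F \<union> K)))" if K: "compact K" for K
  proof -
    obtain R where "R > 0" "\<forall>z \<in> K. norm z \<le> R"
      using compact_imp_bounded[OF K] unfolding bounded_pos by blast
    then have R: "0 \<le> R" "K \<subseteq> cball 0 R" by auto
    have "bounded (\<Union> (holes (F \<union> cball 0 R)) \<union> cball 0 R)"
      using log_imp_bounded_holes[OF assms entire R(1)] by simp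
    moreover have "\<Union> (holes (F \<union> K)) \<inter> F = {}"
      unfolding holes_def using in_components_subset by fastforce
    then have "\<Union> (holes (F \<union> K)) \<subseteq> \<Union> (holes (F \<union> cball 0 R)) \<union> cball 0 R"
      using holes_outside_larger_set[OF R(2), of F] by blast
    ultimately show ?thesis by (rule bounded_subset)
  qed
  then show "arakelian_set F"
    using log_imp_no_holes[OF assms entire] assms by (simp add: arakelian_set_def)
qed

end
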